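(* If $E(\lambda)$ is a $*$-odd $n\times n$ matrix pencil with $\operatorname{rank}E=r\leq n$, then it can be written as $$E(\lambda)=(a_1\mathfrak i+\lambda b_1)u_1u_1^*+\cdots+(a_\ell\mathfrak i+\lambda b_\ell)u_\ell u_\ell^*+v_1w_1(\lambda)^*+\cdots+v_sw_s(\lambda)^*-w_1(-\lambda)v_1^*-\cdots-w_s(-\lambda)v_s^*,$$ where $\mathfrak i$ is the imaginary unit, $a_i,b_i\in\mathbb R$ for $i=1,\dots,\ell$, $u_i,v_j,w_j\in\mathbb C[\lambda]^n$, and (i) $\ell+2s=r$; (ii) $\deg u_1=\cdots=\deg u_\ell=0=\deg v_1=\cdots=\deg v_s$ and $\deg w_1,\dots,\deg w_s\leq 1$.
   Context: A matrix pencil $E(\lambda)=A+\lambda B$ with $A,B\in\mathbb C^{n\times n}$ is $*$-odd if $A^*=-A$ and $B^*=B$. Its rank is the normal rank, i.e. the rank as a matrix over the field of rational functions, $\max_{\lambda\in\mathbb C}\operatorname{rank}(A+\lambda B)$. For $v(\lambda)\in\mathbb C[\lambda]^n$, $\deg v$ is the largest degree of the entries of $v$; so $\deg v=0$ means that $v$ is a constant vector in $\mathbb C^n$. For $w(\lambda)=w_0+\lambda w_1$ with $w_0,w_1\in\mathbb C^n$, $w(\lambda)^*$ denotes $w_0^*+\lambda w_1^*$ (conjugate transpose is applied to coefficients only, not to $\lambda$). *)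

theory Defs
  imports "HOL-Analysis.Analysis" "HOL-Computational_Algebra.Computational_Algebra"
begin

text \<open>
  Polynomial vectors and matrices in the indeterminate \<open>\<lambda>\<close> have entries in
  \<^typ>\<open>complex poly\<close>; the index type \<open>'n\<close> plays the role of \<open>{1, \<dots>, n}\<close>.
\<close>

definition conj_transpose :: "complex ^ 'n ^ 'm \<Rightarrow> complex ^ 'm ^ 'n" where
  "conj_transpose M = map_matrix cnj (transpose M)"

definition star_odd :: "complex ^ 'n ^ 'n \<Rightarrow> complex ^ 'n ^ 'n \<Rightarrow> bool" where
  "star_odd A B \<longleftrightarrow> conj_transpose A = - A \<and> conj_transpose B = B"

text \<open>The pencil \<open>A + \<lambda> B\<close>.\<close>

definition pencil :: "complex ^ 'n ^ 'n \<Rightarrow> complex ^ 'n ^ 'n \<Rightarrow> complex poly ^ 'n ^ 'n" where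
  "pencil A B = (\<chi> i j. [:A $ i $ j, B $ i $ j:])"

text \<open>The rank over the field \<open>\<complex>(\<lambda>)\<close>, which is the type \<^typ>\<open>complex poly fract\<close>.\<close>

definition normal_rank :: "complex poly ^ 'n ^ 'm \<Rightarrow> nat" where
  "normal_rank E = rank (map_matrix to_fract E)"

text \<open>Since the zero polynomial has degree \<open>0\<close> in the library, \<open>vec_degree v = 0\<close> says exactly
  that \<open>v\<close> is a constant vector, possibly zero.\<close>

definition vec_degree :: "complex poly ^ 'n \<Rightarrow> nat" where
  "vec_degree v = Max (range (\<lambda>i. degree (v $ i)))"

text \<open>The matrix \<open>v(\<lambda>) w(\<lambda>)\<^sup>*\<close>. The conjugation acts on the coefficients of \<open>w\<close> only and
  leaves \<open>\<lambda>\<close> untouched.\<close>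

definition outer_star :: "complex poly ^ 'm \<Rightarrow> complex poly ^ 'n \<Rightarrow> complex poly ^ 'n ^ 'm" where
  "outer_star v w = (\<chi> i j. v $ i * map_poly cnj (w $ j))"

text \<open>The vector \<open>w(-\<lambda>)\<close>.\<close>

definition reflect_vec :: "complex poly ^ 'n \<Rightarrow> complex poly ^ 'n" where
  "reflect_vec w = (\<chi> i. pcompose (w $ i) [:0, -1:])"

definition smult_matrix :: "complex poly \<Rightarrow> complex poly ^ 'n ^ 'm \<Rightarrow> complex poly ^ 'n ^ 'm" where
  "smult_matrix p M = map_matrix ((*) p) M"

end

theory Submission
  imports Defs
begin

text \<open>
  Peel off one square \<open>u u\<^sup>*\<close> or one pair \<open>v w\<^sup>* - w(-\<lambda>) v\<^sup>*\<close> at a time, paying for a square with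
  one unit of rank and for a pair with two.

  The starting point is a vector \<open>k\<close> such that \<open>A k = \<alpha> p\<close> and \<open>B k = \<beta> p\<close> with \<open>p \<noteq> 0\<close> and
  \<open>\<alpha>\<close>, \<open>\<beta>\<close> not both zero (\<open>deflating_vector\<close>). If some \<open>k\<close> in the kernel of \<open>A\<close> has \<open>B k \<noteq> 0\<close>, then
  \<open>p = B k\<close> works. Otherwise \<open>A\<close> and \<open>B\<close> being Hermitian up to sign forces the range of \<open>B\<close> into
  the range of \<open>A\<close>. If \<open>g\<close> is a right inverse of \<open>A\<close> on its range, \<open>B \<circ> g\<close> is an operator on that
  range, and any eigenvector \<open>p\<close> of it gives \<open>k = g p\<close>.

  Now choose \<open>z\<close> with \<open>p\<^sup>* z = 1\<close> and pass from \<open>E\<close> to \<open>E' = (I - p z\<^sup>*) E (I - z p\<^sup>*)\<close>, the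
  restriction of the form \<open>E\<close> to the hyperplane \<open>p\<^sup>* x = 0\<close>, extended by zero along \<open>z\<close>. It is again
  \<open>*\<close>-odd, and \<open>E - E' = p w(\<lambda>)\<^sup>* - w(-\<lambda>) p\<^sup>*\<close> is always a pair. If \<open>p\<^sup>* k \<noteq> 0\<close>, choosing for \<open>z\<close> a
  multiple of \<open>k\<close> even makes it a single term \<open>(a \<i> + \<lambda> b) p p\<^sup>*\<close> (\<open>odd_decomposable_of_deflate\<close>).

  The rank is controlled through row spaces over \<open>\<complex>(\<lambda>)\<close> (\<open>normal_rank_deflate\<close>). The row \<open>p\<^sup>*\<close> is
  in the row space of \<open>E\<close>, because it is proportional to \<open>k\<^sup>* E\<close>; hence the row space of \<open>E'\<close> lies in
  that of \<open>E\<close>. It does not contain \<open>p\<^sup>*\<close>, since \<open>E' z = 0\<close>, so at least one dimension is lost. If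
  \<open>p\<^sup>* k = 0\<close>, then also \<open>E' k = 0\<close> while \<open>E k \<noteq> 0\<close>, and a second dimension is lost, which pays for
  the pair. Induction on an upper bound of the rank finishes the proof. Should the zero pencil be
  reached with a positive bound, zero squares fill up the count.
\<close>

no_notation fps_nth (infixl \<open>$\<close> 75)

section \<open>Eigenvectors in invariant subspaces\<close>

text \<open>
  Krylov argument: among the nonzero polynomials \<open>q\<close> of degree at most the dimension with
  \<open>q(T) y = 0\<close> take one of least degree, and split off a root \<open>\<tau>\<close>. With \<open>q = (X - \<tau>) h\<close>, minimality
  gives \<open>h(T) y \<noteq> 0\<close>, and this vector is the eigenvector. Inside the proof, \<open>act q\<close> is \<open>q(T) y\<close>.
\<close>

lemma eigenvector_in_invariant_subspace:
  fixes T :: "complex ^ 'n \<Rightarrow> complex ^ 'n"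
  assumes lin: "Vector_Spaces.linear (*s) (*s) T"
    and W: "vec.subspace W" and inv: "\<And>y. y \<in> W \<Longrightarrow> T y \<in> W"
    and y: "y \<in> W" "y \<noteq> 0"
  obtains x \<tau> where "x \<in> W" "x \<noteq> 0" "T x = \<tau> *s x"
proof -
  interpret T: Vector_Spaces.linear "(*s)" "(*s)" T by (rule lin)
  define N where "N = CARD('n)"
  define v where "v i = (T ^^ i) y" for i
  define act where "act q = (\<Sum>i\<le>N. coeff q i *s v i)" for q
  have vW: "v i \<in> W" for i
    by (induction i) (use y inv in \<open>auto simp: v_def\<close>)
  have actW: "act q \<in> W" for q
    unfolding act_def by (intro vec.subspace_sum W vec.subspace_scale vW)
  have act_diff: "act (q - h) = act q - act h" for q h
    by (simp add: act_def sum_subtractf vec.scale_left_diff_distrib)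
  have act_smult: "act (smult c q) = c *s act q" for c q
    by (simp add: act_def vec.scale_sum_right)
  have act_X: "act (pCons 0 q) = T (act q)" if deg: "degree q < N" for q
  proof -
    obtain m where m: "N = Suc m" using deg by (cases N) auto
    have "coeff q N = 0" using deg by (simp add: coeff_eq_0)
    hence "T (act q) = (\<Sum>i\<le>m. coeff q i *s v (Suc i))"
      by (simp add: act_def T.sum T.scale m v_def)
    also have "\<dots> = act (pCons 0 q)"
      unfolding act_def m by (subst sum.atMost_Suc_shift) simp
    finally show ?thesis by simp
  qed
  have "\<exists>q. q \<noteq> 0 \<and> degree q \<le> N \<and> act q = 0"
  proof -
    \<comment> \<open>The \<open>N + 1\<close> vectors \<open>y, T y, \<dots>, T\<^sup>N y\<close> satisfy a linear relation, trivially so if two of them coincide.\<close>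
    have "\<exists>c. (\<exists>i\<le>N. c i \<noteq> 0) \<and> (\<Sum>i\<le>N. c i *s v i) = 0"
    proof (cases "inj_on v {..N}")
      case True
      have "vec.dependent (v ` {..N})"
        using vec.independent_bound_general[of "v ` {..N}"] dim_subset_UNIV_cart_gen[of "v ` {..N}"] True
        by (auto simp: card_image N_def)
      then obtain d where d: "\<exists>x\<in>v ` {..N}. d x \<noteq> 0" "(\<Sum>x\<in>v ` {..N}. d x *s x) = 0"
        by (subst (asm) vec.dependent_finite) auto
      have "(\<Sum>i\<le>N. d (v i) *s v i) = 0"
        using d(2) by (simp add: sum.reindex[OF True])
      with d(1) show ?thesis by (intro exI[of _ "\<lambda>i. d (v i)"]) auto
    next
      case False
      then obtain i j where ij: "i \<le> N" "j \<le> N" "i \<noteq> j" "v i = v j"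
        by (auto simp: inj_on_def)
      have "(\<Sum>k\<le>N. ((if k = i then 1 else 0) - (if k = j then 1 else 0)) *s v k) = v i - v j"
        using ij by (simp add: vec.scale_left_diff_distrib sum_subtractf if_distrib[of "\<lambda>c. c *s _"] 
            sum.delta cong: if_cong)
      with ij show ?thesis
        by (intro exI[of _ "\<lambda>k. (if k = i then 1 else 0) - (if k = j then 1 else 0)"]) auto
    qed
    then obtain c i where c: "i \<le> N" "c i \<noteq> 0" "(\<Sum>i\<le>N. c i *s v i) = 0" by auto
    define q where "q = (\<Sum>i\<le>N. monom (c i) i)"
    have co: "coeff q j = (if j \<le> N then c j else 0)" for j
      by (auto simp: q_def coeff_sum)
    have "degree q \<le> N" by (rule degree_le) (simp add: co)
    moreover have "q \<noteq> 0" using c co[of i] by auto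
    moreover have "act q = 0" using c by (simp add: act_def co)
    ultimately show ?thesis by blast
  qed
  then obtain q where q: "q \<noteq> 0" "degree q \<le> N" "act q = 0"
    and qmin: "\<And>h. h \<noteq> 0 \<Longrightarrow> degree h < degree q \<Longrightarrow> act h \<noteq> 0"
    using exists_least_iff[of "\<lambda>m. \<exists>q. degree q = m \<and> q \<noteq> 0 \<and> degree q \<le> N \<and> act q = 0"]
    by (smt (verit) less_imp_le_nat order_less_le_trans)
  have "degree q \<noteq> 0"
  proof
    assume "degree q = 0"
    then obtain c where c: "q = [:c:]" by (rule degree_eq_zeroE)
    have "act q = (\<Sum>i\<le>N. if i = 0 then c *s y else 0)"
      unfolding act_def c by (rule sum.cong) (auto simp: v_def coeff_pCons split: nat.split)
    with q(1,3) c y(2) show False by (simp)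
  qed
  hence "\<not> constant (poly q)" by (simp add: constant_degree)
  then obtain \<tau> where "poly q \<tau> = 0" using fundamental_theorem_of_algebra by blast
  then obtain h where h: "q = [:- \<tau>, 1:] * h" by (auto simp: poly_eq_0_iff_dvd)
  have h0: "h \<noteq> 0" using q(1) h by auto
  have "degree q = degree h + 1" unfolding h using h0 by (subst degree_mult_eq) auto
  hence "act h \<noteq> 0" "degree h < N" using qmin[OF h0] q(2) by auto
  moreover have "q = pCons 0 h - smult \<tau> h" by (simp add: h)
  ultimately have "T (act h) = \<tau> *s act h"
    using q(3) by (simp add: act_diff act_smult act_X)
  with \<open>act h \<noteq> 0\<close> actW that show ?thesis by blast
qed

lemma subspace_range_matrix: "vec.subspace (range ((*v) A))" for A :: "'a::field ^ 'n ^ 'm"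
  by (rule vec.linear_subspace_image[OF matrix_vector_mul_linear_gen vec.subspace_UNIV])

text \<open>
  A subspace is the intersection of the hyperplanes containing it: extend the functional that
  vanishes on the range and maps \<open>y\<close> to \<open>1\<close> to the whole space. Scalars are represented by vectors of
  length one, so that linear extension of vector-valued maps applies.
\<close>

lemma range_matrix_annihilator:
  fixes A :: "'a::field ^ 'n ^ 'm"
  assumes "y \<notin> range ((*v) A)"
  obtains f :: "'a ^ 'm" where "\<And>j. (\<Sum>i\<in>UNIV. f $ i * A $ i $ j) = 0" "(\<Sum>i\<in>UNIV. f $ i * y $ i) \<noteq> 0"
proof -
  let ?W = "range ((*v) A)"
  have W: "vec.subspace ?W" by (rule subspace_range_matrix)
  obtain S where S: "S \<subseteq> ?W" "vec.independent S" "vec.span S = ?W"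
    using vec.basis_exists[of ?W] W vec.span_subspace by metis
  have "vec.independent (insert y S)"
    using S assms by (simp add: vec.independent_insert)
  then obtain \<phi> where \<phi>: "Vector_Spaces.linear (*s) (*s) \<phi>"
    "\<And>x. x \<in> insert y S \<Longrightarrow> \<phi> x = (if x = y then 1 else (0::'a^1))"
    using vec.linear_independent_extend[of "insert y S" "\<lambda>x. if x = y then 1 else (0::'a^1)"] by metis
  have yS: "y \<notin> S" using S assms by auto
  interpret P: Vector_Spaces.linear "(*s)" "(*s)" \<phi> by (rule \<phi>(1))
  define f :: "'a ^ 'm" where "f = (\<chi> i. \<phi> (axis i 1) $ 1)"
  have fx: "(\<Sum>i\<in>UNIV. f $ i * x $ i) = \<phi> x $ 1" for x
  proof -
    have "\<phi> x = \<phi> (\<Sum>i\<in>UNIV. x $ i *s axis i 1)" by (simp add: basis_expansion)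
    also have "\<dots> $ 1 = (\<Sum>i\<in>UNIV. f $ i * x $ i)"
      by (simp add: P.sum P.scale f_def mult.commute)
    finally show ?thesis by simp
  qed
  have zero: "\<phi> x = 0" if "x \<in> ?W" for x
  proof (rule P.eq_0_on_span[of S])
    show "x \<in> vec.span S" using that S by simp
    show "\<phi> b = 0" if "b \<in> S" for b using \<phi>(2)[of b] that yS by auto
  qed
  show ?thesis
  proof (rule that[of f])
    fix j
    have "A *v axis j 1 \<in> ?W" by blast
    from zero[OF this] fx[of "A *v axis j 1"] show "(\<Sum>i\<in>UNIV. f $ i * A $ i $ j) = 0"
      by (simp add: matrix_vector_mult_def axis_def if_distrib cong: if_cong)
  next
    show "(\<Sum>i\<in>UNIV. f $ i * y $ i) \<noteq> 0" using fx[of y] \<phi>(2)[of y] by simp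
  qed
qed

section \<open>The Hermitian form and conjugate transposes\<close>

lemma conj_transpose_nth [simp]: "conj_transpose M $ i $ j = cnj (M $ j $ i)"
  by (simp add: conj_transpose_def transpose_def)

lemma star_odd_nth:
  assumes "star_odd A B"
  shows "cnj (A $ j $ i) = - A $ i $ j" "cnj (B $ j $ i) = B $ i $ j"
proof -
  have "conj_transpose A $ i $ j = (- A) $ i $ j" "conj_transpose B $ i $ j = B $ i $ j"
    using assms by (auto simp: star_odd_def)
  thus "cnj (A $ j $ i) = - A $ i $ j" "cnj (B $ j $ i) = B $ i $ j" by simp_all
qed

definition cdot :: "complex ^ 'n \<Rightarrow> complex ^ 'n \<Rightarrow> complex" where
  "cdot p z = (\<Sum>i\<in>UNIV. cnj (p $ i) * z $ i)"

definition outer :: "complex ^ 'm \<Rightarrow> complex ^ 'n \<Rightarrow> complex ^ 'n ^ 'm" where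
  "outer v w = (\<chi> i j. v $ i * cnj (w $ j))"

lemma outer_nth [simp]: "outer v w $ i $ j = v $ i * cnj (w $ j)"
  by (simp add: outer_def)

lemma outer_mult_vec: "outer v w *v x = cdot w x *s v"
  by (simp add: vec_eq_iff matrix_vector_mult_def cdot_def sum_distrib_left sum_distrib_right mult_ac)

lemma uminus_mult_vec: "(- M) *v x = - (M *v x)" for M :: "complex ^ 'n ^ 'm"
  by (simp add: vec_eq_iff matrix_vector_mult_def sum_negf)

lemma cdot_scale_right: "cdot p (c *s x) = c * cdot p x"
  by (simp add: cdot_def sum_distrib_left mult_ac)

lemma cnj_cdot: "cnj (cdot p x) = cdot x p"
  by (simp add: cdot_def mult.commute)

lemma cdot_adjoint: "cdot (conj_transpose M *v x) y = cdot x (M *v y)"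
proof -
  have "cdot (conj_transpose M *v x) y = (\<Sum>j\<in>UNIV. \<Sum>i\<in>UNIV. M $ i $ j * cnj (x $ i) * y $ j)"
    by (simp add: cdot_def matrix_vector_mult_def sum_distrib_right)
  also have "\<dots> = (\<Sum>i\<in>UNIV. \<Sum>j\<in>UNIV. M $ i $ j * cnj (x $ i) * y $ j)"
    by (rule sum.swap)
  also have "\<dots> = cdot x (M *v y)"
    by (simp add: cdot_def matrix_vector_mult_def sum_distrib_left mult_ac)
  finally show ?thesis .
qed

lemma conj_transpose_conj_transpose [simp]: "conj_transpose (conj_transpose M) = M"
  by (simp add: vec_eq_iff)

lemma cnj_cdot_mult_vec: "cnj (cdot x (M *v y)) = cdot y (conj_transpose M *v x)"
  using cdot_adjoint[of "conj_transpose M" y x] by (simp add: cnj_cdot)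

lemma cdot_self_eq_0_iff: "cdot p p = 0 \<longleftrightarrow> p = 0"
proof -
  have "cdot p p = complex_of_real (\<Sum>i\<in>UNIV. (cmod (p $ i))\<^sup>2)"
    unfolding cdot_def of_real_sum
    by (rule sum.cong) (simp_all add: complex_norm_square mult.commute del: of_real_power)
  also have "\<dots> = 0 \<longleftrightarrow> p = 0"
    by (subst of_real_eq_0_iff, subst sum_nonneg_eq_0_iff) (auto simp: vec_eq_iff)
  finally show ?thesis .
qed

section \<open>Vectors with parallel images under both coefficients\<close>

text \<open>
  When the kernel of \<open>A\<close> is contained in that of \<open>B\<close>, the operator to which the eigenvector lemma is
  applied is \<open>B\<close> after a right inverse of \<open>A\<close>. It preserves the range of \<open>A\<close> because a functional \<open>f\<close>
  that separates \<open>B x\<close> from this range would conjugate to a vector in the kernel of \<open>A\<close> but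
  not of \<open>B\<close>.
\<close>

lemma deflating_vector:
  assumes odd: "star_odd A B" and nz: "A \<noteq> 0 \<or> B \<noteq> 0"
  obtains k p \<alpha> \<beta> where "p \<noteq> 0" "\<alpha> \<noteq> 0 \<or> \<beta> \<noteq> 0" "A *v k = \<alpha> *s p" "B *v k = \<beta> *s p"
proof (cases "\<exists>k. A *v k = 0 \<and> B *v k \<noteq> 0")
  case True
  then obtain k where "A *v k = 0" "B *v k \<noteq> 0" by blast
  thus ?thesis using that[of "B *v k" 0 1 k] by simp
next
  case False
  hence ker: "B *v k = 0" if "A *v k = 0" for k using that by blast
  have "A \<noteq> 0"
    using nz ker by (metis matrix_eq matrix_vector_mult_0)
  then obtain k0 where k0: "A *v k0 \<noteq> 0" by (metis matrix_eq matrix_vector_mult_0)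
  have rng: "B *v x \<in> range ((*v) A)" for x
  proof (rule ccontr)
    assume "B *v x \<notin> range ((*v) A)"
    then obtain f where f: "\<And>j. (\<Sum>i\<in>UNIV. f $ i * A $ i $ j) = 0" 
      "(\<Sum>i\<in>UNIV. f $ i * (B *v x) $ i) \<noteq> 0"
      by (rule range_matrix_annihilator) blast
    define k where "k = (\<chi> i. cnj (f $ i))"
    have "(A *v k) $ j = - cnj (\<Sum>i\<in>UNIV. f $ i * A $ i $ j)" for j
      using star_odd_nth(1)[OF odd]
      by (simp add: matrix_vector_mult_def k_def sum_negf mult.commute)
    hence "A *v k = 0" by (simp add: f vec_eq_iff)
    hence Bk: "B *v k = 0" by (rule ker)
    have "(\<Sum>i\<in>UNIV. f $ i * B $ i $ j) = cnj ((B *v k) $ j)" for j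
      by (simp add: matrix_vector_mult_def k_def star_odd_nth(2)[OF odd] mult.commute)
    hence fB: "(\<Sum>i\<in>UNIV. f $ i * B $ i $ j) = 0" for j by (simp add: Bk)
    have "(\<Sum>i\<in>UNIV. f $ i * (B *v x) $ i) = (\<Sum>j\<in>UNIV. (\<Sum>i\<in>UNIV. f $ i * B $ i $ j) * x $ j)"
      unfolding matrix_vector_mult_def
      by (simp add: sum_distrib_left sum_distrib_right mult.assoc) (rule sum.swap)
    with f(2) fB show False by simp
  qed
  obtain g where g: "Vector_Spaces.linear (*s) (*s) g" "\<And>y. y \<in> range ((*v) A) \<Longrightarrow> A *v g y = y"
    using vec.linear_exists_right_inverse_on[OF matrix_vector_mul_linear_gen[of A] vec.subspace_UNIV]
    by blast
  obtain x \<tau> where x: "x \<in> range ((*v) A)" "x \<noteq> 0" "B *v g x = \<tau> *s x"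
  proof (rule eigenvector_in_invariant_subspace[of "\<lambda>y. B *v g y" "range ((*v) A)" "A *v k0"])
    show "Vector_Spaces.linear (*s) (*s) (\<lambda>y. B *v g y)"
      using Vector_Spaces.linear_compose[OF g(1) matrix_vector_mul_linear_gen[of B]]
      by (simp add: o_def)
    show "vec.subspace (range ((*v) A))" by (rule subspace_range_matrix)
  qed (use rng k0 that in auto)
  show ?thesis
    using that[of x 1 \<tau> "g x"] x g(2) by simp
qed

section \<open>Deflation and the drop of the normal rank\<close>

text \<open>
  This is \<open>(I - p z\<^sup>*) M (I - z p\<^sup>*)\<close>, multiplied out.
\<close>

definition deflate :: "complex ^ 'n ^ 'n \<Rightarrow> complex ^ 'n \<Rightarrow> complex ^ 'n \<Rightarrow> complex ^ 'n ^ 'n" where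
  "deflate M p z = M - outer p (conj_transpose M *v z) - outer (M *v z) p
                     + outer (cdot z (M *v z) *s p) p"

lemma deflate_mult_z:
  assumes "cdot p z = 1"
  shows "deflate M p z *v z = 0"
  using assms
  by (simp add: deflate_def matrix_vector_mult_diff_rdistrib matrix_vector_mult_add_rdistrib
      outer_mult_vec cdot_adjoint)

lemma deflate_mult_k:
  assumes "cdot p z = 1" "cdot p k = 0" "M *v k = \<mu> *s p"
  shows "deflate M p z *v k = 0"
proof -
  have "cdot z p = 1" using assms(1) cnj_cdot[of p z] by simp
  with assms(2,3) show ?thesis
    by (simp add: deflate_def matrix_vector_mult_diff_rdistrib matrix_vector_mult_add_rdistrib
      outer_mult_vec cdot_adjoint cdot_scale_right)
qed

lemma star_odd_deflate:
  assumes odd: "star_odd A B"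
  shows "star_odd (deflate A p z) (deflate B p z)"
proof -
  have A: "conj_transpose A = - A" and B: "conj_transpose B = B"
    using odd by (auto simp: star_odd_def)
  have *: "conj_transpose (deflate M p z) = deflate (conj_transpose M) p z" for M
    using cnj_cdot_mult_vec[of z M z] by (simp add: vec_eq_iff deflate_def)
  have "deflate (- A) p z = - deflate A p z"
  proof -
    have "conj_transpose (- A) = - conj_transpose A" by (simp add: vec_eq_iff)
    moreover have "cdot z (- (A *v z)) = - cdot z (A *v z)" by (simp add: cdot_def sum_negf)
    ultimately have "deflate (- A) p z = - A - outer p (- (conj_transpose A *v z)) - outer (- (A *v z)) p
        + outer ((- cdot z (A *v z)) *s p) p"
      unfolding deflate_def by (simp only: uminus_mult_vec)
    also have "\<dots> = - deflate A p z" by (simp add: vec_eq_iff deflate_def)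
    finally show ?thesis .
  qed
  thus ?thesis by (simp add: star_odd_def * A B)
qed

text \<open>
  The value of a row vector over \<open>\<complex>(\<lambda>)\<close> at a constant column vector \<open>x\<close>, without conjugation.
\<close>

definition row_apply :: "complex ^ 'n \<Rightarrow> complex poly fract ^ 'n \<Rightarrow> complex poly fract" where
  "row_apply x f = (\<Sum>j\<in>UNIV. f $ j * to_fract [:x $ j:])"

lemma pCons_sum: "[:sum f S, sum g S:] = (\<Sum>i\<in>S. [:f i, g i:])"
proof (induction S rule: infinite_finite_induct)
  case (insert x F)
  have "[:sum f (insert x F), sum g (insert x F):] = [:f x, g x:] + [:sum f F, sum g F:]"
    using insert.hyps by simp
  also have "\<dots> = (\<Sum>i\<in>insert x F. [:f i, g i:])"
    unfolding insert.IH using insert.hyps by (subst sum.insert) auto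
  finally show ?case .
qed auto

lemma row_apply_row:
  "row_apply x (row i (map_matrix to_fract (pencil A B)))
     = to_fract [:(A *v x) $ i, (B *v x) $ i:]"
  by (simp add: row_apply_def row_def pencil_def matrix_vector_mult_def pCons_sum
      to_fract_sum mult.commute flip: to_fract_mult)

lemma subspace_row_apply: "vec.subspace {f. row_apply x f = 0}"
  by (auto simp: vec.subspace_def row_apply_def sum.distrib distrib_right mult.assoc
      simp flip: sum_distrib_left)

lemma row_in_span: "row i M \<in> vec.span (rows M)"
  by (rule vec.span_base) (auto simp: rows_def)

text \<open>
  The row spaces satisfy \<open>R' \<subseteq> R\<close>, and \<open>P = p\<^sup>*\<close> lies in \<open>R\<close> but not in \<open>R'\<close> since its value at \<open>z\<close>
  is \<open>1\<close>. If \<open>p\<^sup>* k = 0\<close>, the rows in \<open>R\<close> vanishing at \<open>k\<close> form a space strictly between the two: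
  it contains \<open>P\<close>, but not every row of the pencil, because the pencil maps \<open>k\<close> to a nonzero
  multiple of \<open>p\<close>.
\<close>

lemma normal_rank_deflate:
  assumes odd: "star_odd A B" and pz: "cdot p z = 1"
    and ab: "\<alpha> \<noteq> 0 \<or> \<beta> \<noteq> 0" and k: "A *v k = \<alpha> *s p" "B *v k = \<beta> *s p"
  shows "normal_rank (pencil (deflate A p z) (deflate B p z)) < normal_rank (pencil A B)"
    and "cdot p k = 0 \<Longrightarrow>
           normal_rank (pencil (deflate A p z) (deflate B p z)) + 2 \<le> normal_rank (pencil A B)"
proof -
  define M where "M = map_matrix to_fract (pencil A B)"
  define M' where "M' = map_matrix to_fract (pencil (deflate A p z) (deflate B p z))"
  define P :: "complex poly fract ^ 'a" where "P = (\<chi> j. to_fract [:cnj (p $ j):])"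
  define R where "R = vec.span (rows M)"
  define R' where "R' = vec.span (rows M')"
  have R: "vec.subspace R" "vec.subspace R'" by (simp_all add: R_def R'_def)
  have row_R: "row i M \<in> R" for i by (simp add: R_def row_in_span)
  have eval_P: "row_apply x P = to_fract [:cdot p x:]" for x
  proof -
    have "[:cdot p x:] = (\<Sum>j\<in>UNIV. [:cnj (p $ j):] * [:x $ j:])"
      using pCons_sum[of "\<lambda>j. cnj (p $ j) * x $ j" UNIV "\<lambda>_. 0"] by (simp add: cdot_def mult.commute)
    thus ?thesis by (simp add: row_apply_def P_def to_fract_sum flip: to_fract_mult)
  qed
  have eval_M: "row_apply x (row i M) = to_fract [:(A *v x) $ i, (B *v x) $ i:]" for x i
    by (simp add: M_def row_apply_row)
  have eval_M': "row_apply x (row i M')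
      = to_fract [:(deflate A p z *v x) $ i, (deflate B p z *v x) $ i:]" for x i
    by (simp add: M'_def row_apply_row)
  \<comment> \<open>The combination of the rows with coefficients \<open>x\<^sup>*\<close> is \<open>x\<^sup>* E\<close>, computed through the adjoints of \<open>A\<close> and \<open>B\<close>.\<close>
  have comb: "(\<Sum>i\<in>UNIV. to_fract [:cnj (x $ i):] *s row i M) $ j
      = to_fract [:cnj ((conj_transpose A *v x) $ j), cnj ((conj_transpose B *v x) $ j):]" for x j
    by (simp add: M_def row_def pencil_def matrix_vector_mult_def pCons_sum to_fract_sum
        mult.commute flip: to_fract_mult)
  have comb_R: "(\<Sum>i\<in>UNIV. to_fract [:cnj (x $ i):] *s row i M) \<in> R" for x
    by (intro vec.subspace_sum R vec.subspace_scale row_R)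
  have P_R: "P \<in> R"
  proof -
    \<comment> \<open>\<open>k\<^sup>* E = (-cnj \<alpha> + \<lambda> cnj \<beta>) p\<^sup>*\<close>, the sign coming from \<open>A\<^sup>* = -A\<close>; the factor is invertible.\<close>
    define c where "c = to_fract [:- cnj \<alpha>, cnj \<beta>:]"
    have "c \<noteq> 0" using ab by (simp add: c_def)
    have "c *s P = (\<Sum>i\<in>UNIV. to_fract [:cnj (k $ i):] *s row i M)"
      using odd unfolding vec_eq_iff comb
      by (simp add: star_odd_def uminus_mult_vec k P_def c_def mult.commute flip: to_fract_mult)
    hence "inverse c *s (c *s P) \<in> R"
      using comb_R vec.subspace_scale[OF R(1)] by metis
    thus ?thesis using \<open>c \<noteq> 0\<close> by simp
  qed
  have "row i M' \<in> R" for i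
  proof -
    \<comment> \<open>\<open>E' = E - p (z\<^sup>* E) + d p\<^sup>*\<close> row by row, and all three rows are in \<open>R\<close>; \<open>d\<close> collects the factors of \<open>p\<^sup>*\<close>.\<close>
    define d where "d = to_fract [:cdot z (A *v z) * p $ i - (A *v z) $ i, cdot z (B *v z) * p $ i - (B *v z) $ i:]"
    have "row i M' = row i M - to_fract [:p $ i:] *s (\<Sum>i\<in>UNIV. to_fract [:cnj (z $ i):] *s row i M) + d *s P"
      unfolding vec_eq_iff vector_add_component vector_minus_component vector_smult_component comb
      by (simp add: M'_def M_def row_def pencil_def d_def P_def deflate_def algebra_simps
          flip: to_fract_mult to_fract_add to_fract_diff)
    thus ?thesis
      by (simp only:) (intro vec.subspace_add vec.subspace_diff vec.subspace_scale R row_R comb_R P_R)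
  qed
  hence R'_R: "R' \<subseteq> R"
    unfolding R'_def by (intro vec.span_minimal R) (auto simp: rows_def)
  have R'_eval: "R' \<subseteq> {f. row_apply x f = 0}"
    if "deflate A p z *v x = 0" "deflate B p z *v x = 0" for x
    unfolding R'_def 
    by (intro vec.span_minimal subspace_row_apply) (auto simp: rows_def eval_M' that)
  have "R' \<subseteq> {f. row_apply z f = 0}"
    by (rule R'_eval) (simp_all add: deflate_mult_z pz)
  hence P_R': "P \<notin> R'" using eval_P[of z] pz by auto
  have rank: "normal_rank (pencil A B) = vec.dim R" 
     "normal_rank (pencil (deflate A p z) (deflate B p z)) = vec.dim R'"
    by (simp_all add: normal_rank_def row_rank_def_gen R_def R'_def M_def M'_def)
  have dim_less: "vec.dim U < vec.dim V" if "vec.subspace U" "vec.subspace V" "U \<subset> V" for U V :: "(complex poly fract ^ 'a) set"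
    using that vec.dim_psubset[of U V] by (simp add: vec.span_eq_iff[THEN iffD2])
  show "normal_rank (pencil (deflate A p z) (deflate B p z)) < normal_rank (pencil A B)"
    unfolding rank by (rule dim_less) (use R R'_R P_R P_R' in auto)
  assume pk: "cdot p k = 0"
  define R1 where "R1 = R \<inter> {f. row_apply k f = 0}"
  have R1: "vec.subspace R1" 
    unfolding R1_def by (intro vec.subspace_inter R subspace_row_apply)
  have "R' \<subseteq> {f. row_apply k f = 0}"
    by (rule R'_eval; rule deflate_mult_k[OF pz pk]; rule k)
  with R'_R have "R' \<subseteq> R1" by (auto simp: R1_def)
  moreover have "P \<in> R1" using P_R eval_P[of k] pk by (simp add: R1_def)
  ultimately have R'_R1: "vec.dim R' < vec.dim R1"
    by (intro dim_less) (use R R1 P_R' in auto)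
  have "vec.dim R1 < vec.dim R"
  proof (rule dim_less)
    have "p \<noteq> 0" using pz by (auto simp: cdot_def)
    then obtain i where "p $ i \<noteq> 0" by (auto simp: vec_eq_iff)
    hence "row_apply k (row i M) \<noteq> 0" using ab by (auto simp: eval_M k)
    with row_R[of i] show "R1 \<subset> R" by (auto simp: R1_def)
  qed (use R R1 in auto)
  with R'_R1 show "normal_rank (pencil (deflate A p z) (deflate B p z)) + 2 \<le> normal_rank (pencil A B)"
    by (simp add: rank)
qed

section \<open>Decompositions and how deflation extends them\<close>

definition odd_decomposable :: "nat \<Rightarrow> nat \<Rightarrow> complex ^ 'n ^ 'n \<Rightarrow> complex ^ 'n ^ 'n \<Rightarrow> bool" where
  "odd_decomposable l s A B \<longleftrightarrow> (\<exists>(a :: nat \<Rightarrow> real) (b :: nat \<Rightarrow> real)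
            (u :: nat \<Rightarrow> complex poly ^ 'n) (v :: nat \<Rightarrow> complex poly ^ 'n)
            (w :: nat \<Rightarrow> complex poly ^ 'n).
           pencil A B =
             (\<Sum>i=1..l. smult_matrix [:complex_of_real (a i) * \<i>, complex_of_real (b i):]
                         (outer_star (u i) (u i)))
             + (\<Sum>j=1..s. outer_star (v j) (w j))
             - (\<Sum>j=1..s. outer_star (reflect_vec (w j)) (v j))
           \<and> (\<forall>i\<in>{1..l}. vec_degree (u i) = 0)
           \<and> (\<forall>j\<in>{1..s}. vec_degree (v j) = 0)
           \<and> (\<forall>j\<in>{1..s}. vec_degree (w j) \<le> 1))"

definition lin_vec :: "complex ^ 'n \<Rightarrow> complex ^ 'n \<Rightarrow> complex poly ^ 'n" where
  "lin_vec x y = (\<chi> i. [:x $ i, y $ i:])"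

lemma vec_degree_lin_vec: "vec_degree (lin_vec x y) \<le> 1" "vec_degree (lin_vec x 0) = 0"
proof -
  show "vec_degree (lin_vec x y) \<le> 1"
    unfolding vec_degree_def by (subst Max_le_iff) (auto simp: lin_vec_def)
qed (simp add: vec_degree_def lin_vec_def)

lemma square_term:
  "smult_matrix [:complex_of_real a * \<i>, complex_of_real b:] (outer_star (lin_vec p 0) (lin_vec p 0))
     = pencil (outer ((complex_of_real a * \<i>) *s p) p) (outer (complex_of_real b *s p) p)"
  by (simp add: vec_eq_iff smult_matrix_def outer_star_def lin_vec_def pencil_def map_poly_pCons mult_ac)

lemma pair_term:
  "outer_star (lin_vec p 0) (lin_vec x y) - outer_star (reflect_vec (lin_vec x y)) (lin_vec p 0)
     = pencil (outer p x - outer x p) (outer p y + outer y p)"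
  by (simp add: vec_eq_iff reflect_vec_def outer_star_def lin_vec_def pencil_def map_poly_pCons
      pcompose_pCons mult_ac)

lemma pencil_add: "pencil (A + A') (B + B') = pencil A B + pencil A' B'"
  by (simp add: vec_eq_iff pencil_def)

text \<open>
  Zero squares fill up the count when the induction reaches the zero pencil. This is why it suffices
  to bound from below by how much each deflation lowers the rank.
\<close>

lemma odd_decomposable_zero: "odd_decomposable l 0 0 (0 :: complex ^ 'n ^ 'n)"
proof -
  have "pencil 0 0 = (0 :: complex poly ^ 'n ^ 'n)" by (simp add: vec_eq_iff pencil_def)
  moreover have "smult_matrix 0 M = 0" for M :: "complex poly ^ 'n ^ 'n" 
    by (simp add: vec_eq_iff smult_matrix_def)
  ultimately show ?thesis
    unfolding odd_decomposable_def
    by (intro exI[of _ "\<lambda>_. 0"] exI[of _ "\<lambda>_. lin_vec 0 0"]) (simp add: vec_degree_lin_vec)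
qed

lemma sum_extend:
  assumes "\<And>i. i \<in> {1..n} \<Longrightarrow> f i = g i" "f (Suc n) = c"
  shows "(\<Sum>i=1..Suc n. f i) = (\<Sum>i=1..n. g i) + (c :: 'a :: comm_monoid_add)"
  using assms by simp

lemma odd_decomposable_add_square:
  assumes "odd_decomposable l s A B"
  shows "odd_decomposable (Suc l) s (A + outer ((complex_of_real a * \<i>) *s p) p)
                                    (B + outer (complex_of_real b *s p) p)"
proof -
  obtain a' b' u v w where d: "pencil A B =
             (\<Sum>i=1..l. smult_matrix [:complex_of_real (a' i) * \<i>, complex_of_real (b' i):]
                         (outer_star (u i) (u i)))
             + (\<Sum>j=1..s. outer_star (v j) (w j))
             - (\<Sum>j=1..s. outer_star (reflect_vec (w j)) (v j))"
     "\<forall>i\<in>{1..l}. vec_degree (u i) = 0" "\<forall>j\<in>{1..s}. vec_degree (v j) = 0"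
     "\<forall>j\<in>{1..s}. vec_degree (w j) \<le> 1"
    using assms unfolding odd_decomposable_def by blast
  let ?a = "a'(Suc l := a)" and ?b = "b'(Suc l := b)" and ?u = "u(Suc l := lin_vec p 0)"
  have "(\<Sum>i=1..Suc l. smult_matrix [:complex_of_real (?a i) * \<i>, complex_of_real (?b i):]
                         (outer_star (?u i) (?u i)))
      = (\<Sum>i=1..l. smult_matrix [:complex_of_real (a' i) * \<i>, complex_of_real (b' i):]
                         (outer_star (u i) (u i)))
        + pencil (outer ((complex_of_real a * \<i>) *s p) p) (outer (complex_of_real b *s p) p)"
    by (rule sum_extend) (auto simp: square_term)
  hence "pencil (A + outer ((complex_of_real a * \<i>) *s p) p) (B + outer (complex_of_real b *s p) p) =
             (\<Sum>i=1..Suc l. smult_matrix [:complex_of_real (?a i) * \<i>, complex_of_real (?b i):]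
                         (outer_star (?u i) (?u i)))
             + (\<Sum>j=1..s. outer_star (v j) (w j))
             - (\<Sum>j=1..s. outer_star (reflect_vec (w j)) (v j))"
    unfolding pencil_add d(1) by (simp only: algebra_simps)
  moreover have "\<forall>i\<in>{1..Suc l}. vec_degree (?u i) = 0"
    using d(2) by (auto simp: vec_degree_lin_vec)
  ultimately show ?thesis
    unfolding odd_decomposable_def using d(3,4) by blast
qed

lemma odd_decomposable_add_pair:
  assumes "odd_decomposable l s A B"
  shows "odd_decomposable l (Suc s) (A + (outer p x - outer x p)) (B + (outer p y + outer y p))"
proof -
  obtain a b u v w where d: "pencil A B =
             (\<Sum>i=1..l. smult_matrix [:complex_of_real (a i) * \<i>, complex_of_real (b i):]
                         (outer_star (u i) (u i)))
             + (\<Sum>j=1..s. outer_star (v j) (w j))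
             - (\<Sum>j=1..s. outer_star (reflect_vec (w j)) (v j))"
     "\<forall>i\<in>{1..l}. vec_degree (u i) = 0" "\<forall>j\<in>{1..s}. vec_degree (v j) = 0"
     "\<forall>j\<in>{1..s}. vec_degree (w j) \<le> 1"
    using assms unfolding odd_decomposable_def by blast
  let ?v = "v(Suc s := lin_vec p 0)" and ?w = "w(Suc s := lin_vec x y)"
  have 1: "(\<Sum>j=1..Suc s. outer_star (?v j) (?w j))
      = (\<Sum>j=1..s. outer_star (v j) (w j)) + outer_star (lin_vec p 0) (lin_vec x y)"
    by (rule sum_extend) auto
  have 2: "(\<Sum>j=1..Suc s. outer_star (reflect_vec (?w j)) (?v j))
      = (\<Sum>j=1..s. outer_star (reflect_vec (w j)) (v j))
        + outer_star (reflect_vec (lin_vec x y)) (lin_vec p 0)"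
    by (rule sum_extend) auto
  have "pencil (A + (outer p x - outer x p)) (B + (outer p y + outer y p)) =
             (\<Sum>i=1..l. smult_matrix [:complex_of_real (a i) * \<i>, complex_of_real (b i):]
                         (outer_star (u i) (u i)))
             + (\<Sum>j=1..Suc s. outer_star (?v j) (?w j))
             - (\<Sum>j=1..Suc s. outer_star (reflect_vec (?w j)) (?v j))"
    unfolding pencil_add d(1) 1 2 pair_term[symmetric] by (simp only: algebra_simps)
  moreover have "\<forall>j\<in>{1..Suc s}. vec_degree (?v j) = 0"
    using d(3) by (auto simp: vec_degree_lin_vec)
  moreover have "\<forall>j\<in>{1..Suc s}. vec_degree (?w j) \<le> 1"
    using d(4) vec_degree_lin_vec(1)[of x y] by auto
  ultimately show ?thesis
    unfolding odd_decomposable_def using d(2) by blast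
qed

text \<open>
  For general \<open>z\<close> the difference between a matrix and its deflation consists of the two rank-one
  terms through \<open>p\<close> and \<open>M z\<close> and a multiple of \<open>p p\<^sup>*\<close>. Splitting that multiple evenly between the
  first two makes them a pair. If \<open>M z\<close> is itself a multiple of \<open>p\<close>, everything collapses to one
  multiple of \<open>p p\<^sup>*\<close>, whose factor \<open>z\<^sup>* M z\<close> is imaginary for \<open>A\<close> and real for \<open>B\<close>.
\<close>

lemma odd_decomposable_of_deflate:
  assumes odd: "star_odd A B" and pz: "cdot p z = 1"
    and dec: "odd_decomposable l s (deflate A p z) (deflate B p z)"
  shows "odd_decomposable l (Suc s) A B"
    and "A *v z = \<alpha> *s p \<Longrightarrow> B *v z = \<beta> *s p \<Longrightarrow> odd_decomposable (Suc l) s A B"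
proof -
  have A: "conj_transpose A = - A" and B: "conj_transpose B = B"
    using odd by (auto simp: star_odd_def)
  define c where "c = cdot z (A *v z)"
  define d where "d = cdot z (B *v z)"
  have "cnj c = cdot z (- (A *v z))"
    unfolding c_def cnj_cdot_mult_vec A uminus_mult_vec ..
  hence c: "cnj c = - c" by (simp add: c_def cdot_def sum_negf)
  have d: "cnj d = d" unfolding d_def cnj_cdot_mult_vec B ..
  define x where "x = (c / 2) *s p - A *v z"
  define y where "y = B *v z - (d / 2) *s p"
  have "A = deflate A p z + (outer p x - outer x p)"
    by (simp add: vec_eq_iff deflate_def A uminus_mult_vec x_def c flip: c_def) (simp add: field_simps)
  moreover have "B = deflate B p z + (outer p y + outer y p)"
    by (simp add: vec_eq_iff deflate_def B y_def d flip: d_def) (simp add: field_simps)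
  ultimately show "odd_decomposable l (Suc s) A B"
    using odd_decomposable_add_pair[OF dec, of p x y] by simp
  assume Az: "A *v z = \<alpha> *s p" and Bz: "B *v z = \<beta> *s p"
  have zp: "cdot z p = 1" using pz cnj_cdot[of p z] by simp
  have cd: "c = \<alpha>" "d = \<beta>" by (simp_all add: c_def d_def Az Bz cdot_scale_right zp)
  have \<alpha>: "\<alpha> = complex_of_real (Im \<alpha>) * \<i>" using c by (simp add: cd complex_eq_iff)
  have \<beta>: "\<beta> = complex_of_real (Re \<beta>)" using d by (simp add: cd complex_eq_iff)
  have "A = deflate A p z + outer (\<alpha> *s p) p"
    using c by (simp add: vec_eq_iff deflate_def A uminus_mult_vec Az cdot_scale_right zp cd)
  moreover have "B = deflate B p z + outer (\<beta> *s p) p"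
    using d by (simp add: vec_eq_iff deflate_def B Bz cdot_scale_right zp cd)
  ultimately show "odd_decomposable (Suc l) s A B"
    using odd_decomposable_add_square[OF dec, of "Im \<alpha>" p "Re \<beta>"] \<alpha> \<beta> by simp
qed

section \<open>The decomposition theorem\<close>

text \<open>
  The bound \<open>r\<close> on the rank, rather than the rank itself, is what the induction runs on: after a step
  the estimate of the rank drop supplies just an upper bound on the new rank.
\<close>

lemma odd_decomposable_if_normal_rank_le:
  assumes "star_odd A B" "normal_rank (pencil A B) \<le> r"
  shows "\<exists>l s. l + 2 * s = r \<and> odd_decomposable l s A B"
  using assms
proof (induction r arbitrary: A B rule: less_induct)
  case (less r)
  show ?case
  proof (cases "A = 0 \<and> B = 0")
    case True
    with odd_decomposable_zero show ?thesis by (intro exI[of _ r] exI[of _ 0]) auto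
  next
    case False
    then obtain k p \<alpha> \<beta> where p: "p \<noteq> 0" and ab: "\<alpha> \<noteq> 0 \<or> \<beta> \<noteq> 0"
      and k: "A *v k = \<alpha> *s p" "B *v k = \<beta> *s p"
      using deflating_vector[OF less.prems(1)] by metis
    note rank_drop = normal_rank_deflate[OF less.prems(1) _ ab k]
    show ?thesis
    proof (cases "cdot p k = 0")
      case False
      \<comment> \<open>The form does not vanish at \<open>k\<close>: deflate along \<open>k\<close> itself, which costs one square.\<close>
      define z where "z = (1 / cdot p k) *s k"
      have pz: "cdot p z = 1" using False by (simp add: z_def cdot_scale_right)
      have z: "A *v z = (\<alpha> / cdot p k) *s p" "B *v z = (\<beta> / cdot p k) *s p"
        by (simp_all add: z_def vector_scalar_commute k)
      have lt: "normal_rank (pencil (deflate A p z) (deflate B p z)) < r"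
        using rank_drop(1)[OF pz] less.prems(2) by simp
      have "\<exists>l s. l + 2 * s = r - 1 \<and> odd_decomposable l s (deflate A p z) (deflate B p z)"
        by (rule less.IH) (use lt star_odd_deflate[OF less.prems(1)] in auto)
      then obtain l s where "l + 2 * s = r - 1" "odd_decomposable l s (deflate A p z) (deflate B p z)"
        by blast
      with lt odd_decomposable_of_deflate(2)[OF less.prems(1) pz _ z] show ?thesis
        by (intro exI[of _ "Suc l"] exI[of _ s]) auto
    next
      case True
      \<comment> \<open>Here \<open>k\<close> is isotropic for the whole pencil; any \<open>z\<close> with \<open>p\<^sup>* z = 1\<close> serves, and it costs a pair.\<close>
      define z where "z = (1 / cdot p p) *s p"
      have pz: "cdot p z = 1" using p by (simp add: z_def cdot_scale_right cdot_self_eq_0_iff)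
      have le: "normal_rank (pencil (deflate A p z) (deflate B p z)) + 2 \<le> r"
        using rank_drop(2)[OF pz True] less.prems(2) by simp
      have "\<exists>l s. l + 2 * s = r - 2 \<and> odd_decomposable l s (deflate A p z) (deflate B p z)"
        by (rule less.IH) (use le star_odd_deflate[OF less.prems(1)] in auto)
      then obtain l s where "l + 2 * s = r - 2" "odd_decomposable l s (deflate A p z) (deflate B p z)"
        by blast
      with le odd_decomposable_of_deflate(1)[OF less.prems(1) pz] show ?thesis
        by (intro exI[of _ l] exI[of _ "Suc s"]) auto
    qed
  qed
qed

theorem theorem12:
  fixes A B :: "complex ^ 'n ^ 'n" and r :: nat
  assumes "star_odd A B"
    and "normal_rank (pencil A B) = r"
    and "r \<le> CARD('n)"
  shows "\<exists>(l::nat) (s::nat) (a :: nat \<Rightarrow> real) (b :: nat \<Rightarrow> real)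
            (u :: nat \<Rightarrow> complex poly ^ 'n) (v :: nat \<Rightarrow> complex poly ^ 'n)
            (w :: nat \<Rightarrow> complex poly ^ 'n).
           pencil A B =
             (\<Sum>i=1..l. smult_matrix [:complex_of_real (a i) * \<i>, complex_of_real (b i):]
                         (outer_star (u i) (u i)))
             + (\<Sum>j=1..s. outer_star (v j) (w j))
             - (\<Sum>j=1..s. outer_star (reflect_vec (w j)) (v j))
           \<and> l + 2 * s = r
           \<and> (\<forall>i\<in>{1..l}. vec_degree (u i) = 0)
           \<and> (\<forall>j\<in>{1..s}. vec_degree (v j) = 0)
           \<and> (\<forall>j\<in>{1..s}. vec_degree (w j) \<le> 1)"
proof -
  obtain l s where "l + 2 * s = r" "odd_decomposable l s A B"
    using odd_decomposable_if_normal_rank_le[of A B r] assms by auto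
  thus ?thesis unfolding odd_decomposable_def by blast
qed

end
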